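(* Let $-\infty\le a<b\le\infty$. The spaces $HW^p_{(a,b)}$ coincide for all $p\ge 1$; that is, for all $p,p'\ge 1$ one has $HW^{p}_{(a,b)}=HW^{p'}_{(a,b)}$.
   Context: For real $\alpha\le\beta$ let $\Pi_{[\alpha,\beta]}=\{z=x+iy\in\mathbf C:\ x\in\mathbf R,\ \alpha\le y\le\beta\}$, and for $-\infty\le a<b\le\infty$ let $\Pi_{(a,b)}=\{z=x+iy\in\mathbf C:\ a<y<b\}$. A finite exponential sum on $\Pi_{[\alpha,\beta]}$ is a function $\sum_{n=1}^N c_n(y)e^{i\lambda_n x}$ with $\lambda_n\in\mathbf R$ and $c_n$ continuous complex-valued functions on $[\alpha,\beta]$. For $p\ge1$ and complex-valued functions $g,h$ on $\Pi_{[\alpha,\beta]}$ that are measurable and such that $|g(x+iy)|^p$, $|h(x+iy)|^p$ are locally integrable in $x$ for each fixed $y$, the Weyl distance of order $p$ is $$d^{W^p}_{[\alpha,\beta]}(g,h)=\limsup_{T\to\infty}\ \sup_{z\in\Pi_{[\alpha,\beta]}}\left(\frac1{2T}\int_{-T}^{T}|g(z+t)-h(z+t)|^p\,dt\right)^{1/p}.$$ $W^p_{[\alpha,\beta]}$ is the closure of the set of finite exponential sums in this (pseudo)metric: $f\in W^p_{[\alpha,\beta]}$ if for every $\varepsilon>0$ there is a finite exponential sum $Q$ with $d^{W^p}_{[\alpha,\beta]}(f,Q)<\varepsilon$. $HW^p_{(a,b)}$ is the set of holomorphic functions $f$ on $\Pi_{(a,b)}$ whose restriction to $\Pi_{[\alpha,\beta]}$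 belongs to $W^p_{[\alpha,\beta]}$ for all real $\alpha,\beta$ with $a<\alpha<\beta<b$. *)

theory Defs
  imports "HOL-Complex_Analysis.Complex_Analysis"
begin

text \<open>
  A function on a strip is modelled by a total function on \<^typ>\<open>complex\<close>; every notion below
  depends only on its values on the strip in question.
\<close>

definition closed_strip :: "real \<Rightarrow> real \<Rightarrow> complex set" where
  "closed_strip \<alpha> \<beta> = {z. \<alpha> \<le> Im z \<and> Im z \<le> \<beta>}"

definition open_strip :: "ereal \<Rightarrow> ereal \<Rightarrow> complex set" where
  "open_strip a b = {z. a < ereal (Im z) \<and> ereal (Im z) < b}"

definition finite_exp_sums :: "real \<Rightarrow> real \<Rightarrow> (complex \<Rightarrow> complex) set" where
  "finite_exp_sums \<alpha> \<beta> =
    {Q. \<exists>(N::nat) (\<omega> :: nat \<Rightarrow> real) (c :: nat \<Rightarrow> real \<Rightarrow> complex).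
          (\<forall>n\<in>{1..N}. continuous_on {\<alpha>..\<beta>} (c n)) \<and>
          (\<forall>z\<in>closed_strip \<alpha> \<beta>.
             Q z = (\<Sum>n=1..N. c n (Im z) * exp (\<i> * of_real (\<omega> n * Re z))))}"

text \<open>
  The functions between which the Weyl distance is considered. Measurability is Borel
  measurability on the strip, so that all horizontal sections are measurable as well; local
  integrability in \<open>x\<close> is integrability over every compact interval.
\<close>

definition weyl_admissible :: "real \<Rightarrow> real \<Rightarrow> real \<Rightarrow> (complex \<Rightarrow> complex) set" where
  "weyl_admissible p \<alpha> \<beta> =
    {g. g \<in> borel_measurable (restrict_space borel (closed_strip \<alpha> \<beta>)) \<and>
        (\<forall>y\<in>{\<alpha>..\<beta>}. \<forall>u v. set_integrable lborel {u..v} (\<lambda>x. norm (g (Complex x y)) powr p))}"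

text \<open>
  For admissible \<open>g\<close> and \<open>h\<close> each mean value is a finite real number, but the supremum over the
  strip may be infinite; hence the extended real values.
\<close>

definition weyl_dist ::
    "real \<Rightarrow> real \<Rightarrow> real \<Rightarrow> (complex \<Rightarrow> complex) \<Rightarrow> (complex \<Rightarrow> complex) \<Rightarrow> ereal" where
  "weyl_dist p \<alpha> \<beta> g h =
    Limsup at_top (\<lambda>T::real. SUP z\<in>closed_strip \<alpha> \<beta>.
      ereal ((1 / (2 * T) *
        (LINT t:{-T..T}|lborel. norm (g (z + of_real t) - h (z + of_real t)) powr p)) powr (1 / p)))"

definition weyl_space :: "real \<Rightarrow> real \<Rightarrow> real \<Rightarrow> (complex \<Rightarrow> complex) set" where
  "weyl_space p \<alpha> \<beta> =
    {f \<in> weyl_admissible p \<alpha> \<beta>.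
       \<forall>\<epsilon>::real. \<epsilon> > 0 \<longrightarrow> (\<exists>Q\<in>finite_exp_sums \<alpha> \<beta>. weyl_dist p \<alpha> \<beta> f Q < ereal \<epsilon>)}"

definition holo_weyl_space :: "real \<Rightarrow> ereal \<Rightarrow> ereal \<Rightarrow> (complex \<Rightarrow> complex) set" where
  "holo_weyl_space p a b =
    {f. f holomorphic_on open_strip a b \<and>
        (\<forall>\<alpha> \<beta> :: real. a < ereal \<alpha> \<longrightarrow> \<alpha> < \<beta> \<longrightarrow> ereal \<beta> < b \<longrightarrow> f \<in> weyl_space p \<alpha> \<beta>)}"

end

theory Submission
  imports Defs
begin

text \<open>
  A function in \<open>HW\<^sup>p\<close> is bounded on closed substrips: its means over horizontal segments of
  some fixed length \<open>T\<close> are bounded, so with a primitive \<open>G\<close> of \<open>f\<close> the functions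
  \<open>G(z + h) - G(z)\<close>, \<open>0 \<le> h \<le> T\<close>, are uniformly bounded; by Cauchy's inequality so are their
  derivatives \<open>f(z + h) - f(z)\<close> on a smaller strip, and averaging over \<open>h\<close> bounds \<open>f\<close>.

  If \<open>\<bar>f\<bar> \<le> M\<close> and \<open>Q\<close> is an exponential sum close to \<open>f\<close> in the mean of order \<open>p\<close>, let \<open>\<phi>\<close> be
  the nearest-point retraction onto the disc of radius \<open>M\<close>. It is \<open>1\<close>-Lipschitz, so \<open>\<phi> \<circ> Q\<close> is
  at least as close to \<open>f\<close>, and by Stone-Weierstrass \<open>\<phi> \<circ> Q\<close> is a uniform limit of polynomials
  in \<open>Q\<close> and its conjugate, which are again exponential sums. The difference is now bounded
  independently of \<open>Q\<close>, and on bounded functions means of order \<open>p\<close> control means of order \<open>q\<close>.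
\<close>

section \<open>Finite exponential sums: algebra, real polynomials, boundedness\<close>

text \<open>Frees the index set from the form \<open>{1..N}\<close>, so that sums and products of
  exponential sums can be indexed by disjoint unions and Cartesian products.\<close>

lemma finite_exp_sums_setI:
  assumes "finite I" "\<And>i. i \<in> I \<Longrightarrow> continuous_on {\<alpha>..\<beta>} (c i)"
    and Q: "\<And>z. z \<in> closed_strip \<alpha> \<beta> \<Longrightarrow>
      Q z = (\<Sum>i\<in>I. c i (Im z) * exp (\<i> * of_real (\<omega> i * Re z)))"
  shows "Q \<in> finite_exp_sums \<alpha> \<beta>"
proof -
  obtain h where h: "bij_betw h {1..card I} I"
    using ex_bij_betw_nat_finite_1[OF \<open>finite I\<close>] by blast
  have "Q z = (\<Sum>n=1..card I. (c \<circ> h) n (Im z) * exp (\<i> * of_real ((\<omega> \<circ> h) n * Re z)))"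
    if "z \<in> closed_strip \<alpha> \<beta>" for z
    unfolding Q[OF that] o_def by (rule sum.reindex_bij_betw[OF h, symmetric])
  moreover have "continuous_on {\<alpha>..\<beta>} ((c \<circ> h) n)" if "n \<in> {1..card I}" for n
    using assms(2) bij_betwE[OF h] that by auto
  ultimately show ?thesis
    unfolding finite_exp_sums_def by blast
qed

lemma finite_exp_sumsE:
  assumes "Q \<in> finite_exp_sums \<alpha> \<beta>"
  obtains I :: "nat set" and c \<omega> where
    "finite I" "\<forall>i\<in>I. continuous_on {\<alpha>..\<beta>} (c i)"
    "\<forall>z\<in>closed_strip \<alpha> \<beta>.
      Q z = (\<Sum>i\<in>I. c i (Im z) * exp (\<i> * of_real (\<omega> i * Re z)))"
proof -
  obtain N :: nat and \<omega> :: "nat \<Rightarrow> real" and c :: "nat \<Rightarrow> real \<Rightarrow> complex" where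
    "\<forall>n\<in>{1..N}. continuous_on {\<alpha>..\<beta>} (c n)"
    "\<forall>z\<in>closed_strip \<alpha> \<beta>. Q z = (\<Sum>n=1..N. c n (Im z) * exp (\<i> * of_real (\<omega> n * Re z)))"
    using assms unfolding finite_exp_sums_def by (elim CollectE exE conjE)
  then show thesis
    by (intro that[of "{1..N}" c \<omega>]) auto
qed

lemma finite_exp_sums_const: "(\<lambda>z. k) \<in> finite_exp_sums \<alpha> \<beta>"
  by (rule finite_exp_sums_setI[where I = "{()}" and c = "\<lambda>_ _. k" and \<omega> = "\<lambda>_. 0"]) auto

lemma finite_exp_sums_add:
  assumes "P \<in> finite_exp_sums \<alpha> \<beta>" "Q \<in> finite_exp_sums \<alpha> \<beta>"
  shows "(\<lambda>z. P z + Q z) \<in> finite_exp_sums \<alpha> \<beta>"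
proof -
  obtain I :: "nat set" and c \<omega> where P: "finite I"
    "\<forall>i\<in>I. continuous_on {\<alpha>..\<beta>} (c i)"
    "\<forall>z\<in>closed_strip \<alpha> \<beta>. P z = (\<Sum>i\<in>I. c i (Im z) * exp (\<i> * of_real (\<omega> i * Re z)))"
    using assms(1) by (rule finite_exp_sumsE)
  obtain J :: "nat set" and d \<nu> where Q: "finite J"
    "\<forall>i\<in>J. continuous_on {\<alpha>..\<beta>} (d i)"
    "\<forall>z\<in>closed_strip \<alpha> \<beta>. Q z = (\<Sum>i\<in>J. d i (Im z) * exp (\<i> * of_real (\<nu> i * Re z)))"
    using assms(2) by (rule finite_exp_sumsE)
  show ?thesis
    by (rule finite_exp_sums_setI[where I = "I <+> J" and c = "case_sum c d" and \<omega> = "case_sum \<omega> \<nu>"])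
       (use P Q in \<open>auto simp: sum.Plus\<close>)
qed

lemma finite_exp_sums_mult:
  assumes "P \<in> finite_exp_sums \<alpha> \<beta>" "Q \<in> finite_exp_sums \<alpha> \<beta>"
  shows "(\<lambda>z. P z * Q z) \<in> finite_exp_sums \<alpha> \<beta>"
proof -
  obtain I :: "nat set" and c \<omega> where P: "finite I"
    "\<forall>i\<in>I. continuous_on {\<alpha>..\<beta>} (c i)"
    "\<forall>z\<in>closed_strip \<alpha> \<beta>. P z = (\<Sum>i\<in>I. c i (Im z) * exp (\<i> * of_real (\<omega> i * Re z)))"
    using assms(1) by (rule finite_exp_sumsE)
  obtain J :: "nat set" and d \<nu> where Q: "finite J"
    "\<forall>i\<in>J. continuous_on {\<alpha>..\<beta>} (d i)"
    "\<forall>z\<in>closed_strip \<alpha> \<beta>. Q z = (\<Sum>i\<in>J. d i (Im z) * exp (\<i> * of_real (\<nu> i * Re z)))"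
    using assms(2) by (rule finite_exp_sumsE)
  show ?thesis
  proof (rule finite_exp_sums_setI)
    show "finite (I \<times> J)"
      using P Q by simp
    show "continuous_on {\<alpha>..\<beta>} ((\<lambda>(i, j) y. c i y * d j y) ij)" if "ij \<in> I \<times> J" for ij
      using that P(2) Q(2) by (auto intro!: continuous_intros)
    show "P z * Q z = (\<Sum>ij\<in>I \<times> J. (\<lambda>(i, j) y. c i y * d j y) ij (Im z) *
        exp (\<i> * of_real ((\<lambda>(i, j). \<omega> i + \<nu> j) ij * Re z)))" if "z \<in> closed_strip \<alpha> \<beta>" for z
      unfolding P(3)[rule_format, OF that] Q(3)[rule_format, OF that] sum_product sum.cartesian_product
      by (intro sum.cong) (auto simp: algebra_simps exp_add)
  qed
qed

lemma finite_exp_sums_cnj: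
  assumes "Q \<in> finite_exp_sums \<alpha> \<beta>"
  shows "(\<lambda>z. cnj (Q z)) \<in> finite_exp_sums \<alpha> \<beta>"
proof -
  obtain J :: "nat set" and d \<nu> where Q: "finite J"
    "\<forall>i\<in>J. continuous_on {\<alpha>..\<beta>} (d i)"
    "\<forall>z\<in>closed_strip \<alpha> \<beta>. Q z = (\<Sum>i\<in>J. d i (Im z) * exp (\<i> * of_real (\<nu> i * Re z)))"
    using assms(1) by (rule finite_exp_sumsE)
  show ?thesis
    by (rule finite_exp_sums_setI[where I = J and c = "\<lambda>j y. cnj (d j y)" and \<omega> = "\<lambda>j. - \<nu> j"])
       (use Q in \<open>auto simp: exp_cnj intro!: continuous_intros\<close>)
qed

lemma finite_exp_sums_Re:
  assumes "Q \<in> finite_exp_sums \<alpha> \<beta>"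
  shows "(\<lambda>z. of_real (Re (Q z))) \<in> finite_exp_sums \<alpha> \<beta>"
proof -
  have "of_real (Re (Q z)) = 1/2 * (Q z + cnj (Q z))" for z
    by (simp add: complex_add_cnj)
  then show ?thesis
    using assms by (simp only:) (intro finite_exp_sums_mult finite_exp_sums_add finite_exp_sums_cnj finite_exp_sums_const)
qed

lemma finite_exp_sums_real_linear:
  fixes l :: "complex \<Rightarrow> real"
  assumes "bounded_linear l" "Q \<in> finite_exp_sums \<alpha> \<beta>"
  shows "(\<lambda>z. of_real (l (Q z))) \<in> finite_exp_sums \<alpha> \<beta>"
proof -
  interpret bounded_linear l by fact
  \<comment> \<open>A real-linear functional is determined by its values at 1 and i. The imaginary
    part is written as the real part of -i w, so that only closure under real parts is
    needed.\<close>
  have "l w = l 1 * Re w + l \<i> * Re (- \<i> * w)" for w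
  proof -
    have "l w = l (Re w *\<^sub>R 1 + Im w *\<^sub>R \<i>)"
      by (metis complex_eq scaleR_conv_of_real mult.commute mult.right_neutral)
    then show ?thesis
      by (simp only: add scaleR) simp
  qed
  then have "of_real (l (Q z)) =
      (of_real (l 1) * of_real (Re (Q z)) + of_real (l \<i>) * of_real (Re (- \<i> * Q z)) :: complex)" for z
    by (metis of_real_add of_real_mult)
  then show ?thesis
    using assms(2)
    by (simp only:) (intro finite_exp_sums_mult finite_exp_sums_add finite_exp_sums_Re finite_exp_sums_const)
qed

text \<open>Real polynomial functions are generated inductively from bounded linear functionals and
  constants by sums and products, and exponential sums are closed under each of these. Such a
  polynomial is one in the two real coordinates, not in the complex variable; conjugates enter here
  through the real parts.\<close>

lemma finite_exp_sums_real_polynomial: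
  fixes g :: "complex \<Rightarrow> real"
  assumes "real_polynomial_function g" "Q \<in> finite_exp_sums \<alpha> \<beta>"
  shows "(\<lambda>z. of_real (g (Q z))) \<in> finite_exp_sums \<alpha> \<beta>"
  using assms(1)
  by induction
     (simp_all add: finite_exp_sums_real_linear finite_exp_sums_const finite_exp_sums_add
        finite_exp_sums_mult assms(2))

lemma finite_exp_sums_polynomial:
  fixes g :: "complex \<Rightarrow> complex"
  assumes "polynomial_function g" "Q \<in> finite_exp_sums \<alpha> \<beta>"
  shows "(\<lambda>z. g (Q z)) \<in> finite_exp_sums \<alpha> \<beta>"
proof -
  have "real_polynomial_function (Re \<circ> g)" "real_polynomial_function (Im \<circ> g)"
    using assms(1) bounded_linear_Re bounded_linear_Im unfolding polynomial_function_def by blast+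
  from this[THEN finite_exp_sums_real_polynomial, OF assms(2)]
  have "(\<lambda>z. of_real (Re (g (Q z))) + \<i> * of_real (Im (g (Q z)))) \<in> finite_exp_sums \<alpha> \<beta>"
    by (intro finite_exp_sums_add finite_exp_sums_mult finite_exp_sums_const) simp_all
  then show ?thesis
    by (simp flip: complex_eq)
qed

lemma continuous_on_finite_exp_sums:
  assumes "Q \<in> finite_exp_sums \<alpha> \<beta>"
  shows "continuous_on (closed_strip \<alpha> \<beta>) Q"
proof -
  obtain J :: "nat set" and d \<nu> where Q: "finite J"
    "\<forall>i\<in>J. continuous_on {\<alpha>..\<beta>} (d i)"
    "\<forall>z\<in>closed_strip \<alpha> \<beta>. Q z = (\<Sum>i\<in>J. d i (Im z) * exp (\<i> * of_real (\<nu> i * Re z)))"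
    using assms(1) by (rule finite_exp_sumsE)
  have "continuous_on (closed_strip \<alpha> \<beta>) (\<lambda>z. d j (Im z))" if "j \<in> J" for j
    by (rule continuous_on_compose2[OF Q(2)[rule_format, OF that]]) (auto simp: closed_strip_def intro!: continuous_intros)
  then have "continuous_on (closed_strip \<alpha> \<beta>) (\<lambda>z. \<Sum>i\<in>J. d i (Im z) * exp (\<i> * of_real (\<nu> i * Re z)))"
    by (intro continuous_intros)
  then show ?thesis
    by (simp add: Q(3) cong: continuous_on_cong)
qed

text \<open>The frequencies are real, so every exponential has modulus one, and the coefficients are
  bounded because they are continuous on a compact interval. The maximum with 1 keeps the bound
  positive whatever the chosen \<open>b j\<close> are.\<close>

lemma bounded_finite_exp_sums:
  assumes "Q \<in> finite_exp_sums \<alpha> \<beta>"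
  obtains B where "0 < B" "\<And>z. z \<in> closed_strip \<alpha> \<beta> \<Longrightarrow> norm (Q z) \<le> B"
proof -
  obtain J :: "nat set" and d \<nu> where Q: "finite J"
    "\<forall>i\<in>J. continuous_on {\<alpha>..\<beta>} (d i)"
    "\<forall>z\<in>closed_strip \<alpha> \<beta>. Q z = (\<Sum>i\<in>J. d i (Im z) * exp (\<i> * of_real (\<nu> i * Re z)))"
    using assms(1) by (rule finite_exp_sumsE)
  have "\<exists>b. \<forall>y\<in>{\<alpha>..\<beta>}. norm (d j y) \<le> b" if "j \<in> J" for j
    using compact_imp_bounded[OF compact_continuous_image[OF Q(2)[rule_format, OF that]]]
    by (force simp: bounded_iff)
  then obtain b where b: "\<And>j y. j \<in> J \<Longrightarrow> y \<in> {\<alpha>..\<beta>} \<Longrightarrow> norm (d j y) \<le> b j"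
    by metis
  have "norm (Q z) \<le> max 1 (\<Sum>j\<in>J. b j)" if "z \<in> closed_strip \<alpha> \<beta>" for z
  proof -
    have "norm (Q z) \<le> (\<Sum>j\<in>J. b j)"
      unfolding Q(3)[rule_format, OF that] using b that
      by (intro sum_norm_le) (auto simp: norm_mult closed_strip_def)
    then show ?thesis by simp
  qed
  then show thesis
    by (intro that[of "max 1 (\<Sum>j\<in>J. b j)"]) auto
qed

section \<open>The Weyl distance between continuous functions\<close>

lemma continuous_on_horizontal_line:
  assumes "continuous_on (closed_strip \<alpha> \<beta>) f" "z \<in> closed_strip \<alpha> \<beta>"
  shows "continuous_on A (\<lambda>t::real. f (z + of_real t))"
  by (rule continuous_on_compose2[OF assms(1)])
     (use assms(2) in \<open>auto simp: closed_strip_def intro!: continuous_intros\<close>)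

lemma continuous_on_powr_norm_diff:
  fixes p :: real
  assumes "continuous_on (closed_strip \<alpha> \<beta>) g" "continuous_on (closed_strip \<alpha> \<beta>) h"
    and "z \<in> closed_strip \<alpha> \<beta>" "1 \<le> p"
  shows "continuous_on A (\<lambda>t::real. norm (g (z + of_real t) - h (z + of_real t)) powr p)"
proof (rule continuous_on_powr')
  show "continuous_on A (\<lambda>t::real. norm (g (z + of_real t) - h (z + of_real t)))"
    by (intro continuous_on_norm continuous_on_diff continuous_on_horizontal_line[OF _ assms(3)] assms)
qed (use assms(4) in \<open>auto intro: continuous_on_const\<close>)

lemma set_lborel_integral_eq_integral:
  fixes f :: "real \<Rightarrow> real"
  assumes "continuous_on {u..v} f"
  shows "(LINT t:{u..v}|lborel. f t) = integral {u..v} f"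
  by (intro set_borel_integral_eq_integral borel_integrable_atLeastAtMost' assms)

lemma weyl_admissible_continuous:
  assumes "continuous_on (closed_strip \<alpha> \<beta>) f" "0 < p"
  shows "f \<in> weyl_admissible p \<alpha> \<beta>"
  unfolding weyl_admissible_def
proof (intro CollectI conjI ballI allI)
  show "f \<in> borel_measurable (restrict_space borel (closed_strip \<alpha> \<beta>))"
    by (rule borel_measurable_continuous_on_restrict) fact
  fix y u v :: real assume "y \<in> {\<alpha>..\<beta>}"
  then have "continuous_on {u..v} (\<lambda>x. f (Complex 0 y + of_real x))"
    by (intro continuous_on_horizontal_line[OF assms(1)]) (simp add: closed_strip_def)
  moreover have "Complex 0 y + of_real x = Complex x y" for x
    by (simp add: complex_eq_iff)
  ultimately show "set_integrable lborel {u..v} (\<lambda>x. norm (f (Complex x y)) powr p)"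
    using \<open>0 < p\<close>
    by (intro borel_integrable_atLeastAtMost') (auto intro!: continuous_intros continuous_on_powr')
qed

text \<open>Trades the limsup of suprema for an inequality between integrals, free of roots and
  quotients, that holds for all large T uniformly in z. The converse passage
  \<open>weyl_dist_leI\<close> yields only a non-strict bound on the distance.\<close>

lemma weyl_dist_lessD:
  assumes less: "weyl_dist p \<alpha> \<beta> g h < ereal \<epsilon>" and "1 \<le> p"
    and g: "continuous_on (closed_strip \<alpha> \<beta>) g" and h: "continuous_on (closed_strip \<alpha> \<beta>) h"
  shows "\<forall>\<^sub>F T in at_top. \<forall>z\<in>closed_strip \<alpha> \<beta>.
    integral {-T..T} (\<lambda>t. norm (g (z + of_real t) - h (z + of_real t)) powr p) \<le> 2 * T * \<epsilon> powr p"
  using Limsup_lessD[OF less[unfolded weyl_dist_def]] eventually_gt_at_top[of 0]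
proof eventually_elim
  case (elim T)
  show ?case
  proof
    fix z assume z: "z \<in> closed_strip \<alpha> \<beta>"
    let ?k = "\<lambda>t. norm (g (z + of_real t) - h (z + of_real t)) powr p"
    have cont: "continuous_on {-T..T} ?k"
      by (rule continuous_on_powr_norm_diff) fact+
    define m where "m = 1 / (2 * T) * integral {-T..T} ?k"
    have "ereal (m powr (1 / p)) < ereal \<epsilon>"
      using SUP_upper[OF z] elim(1)
      unfolding m_def set_lborel_integral_eq_integral[OF cont, symmetric] by (rule order.strict_trans1)
    then have "m powr (1 / p) \<le> \<epsilon>" by simp
    then have "(m powr (1 / p)) powr p \<le> \<epsilon> powr p"
      using \<open>1 \<le> p\<close> by (intro powr_mono2) auto
    moreover have "0 \<le> m"
      unfolding m_def using elim(2) by (intro mult_nonneg_nonneg integral_nonneg integrable_continuous_real cont) auto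
    ultimately have "m \<le> \<epsilon> powr p"
      using \<open>1 \<le> p\<close> by (simp add: powr_powr)
    then show "integral {-T..T} ?k \<le> 2 * T * \<epsilon> powr p"
      unfolding m_def using elim(2) by (simp add: field_simps)
  qed
qed

lemma weyl_dist_leI:
  assumes le: "\<forall>\<^sub>F T in at_top. \<forall>z\<in>closed_strip \<alpha> \<beta>.
    integral {-T..T} (\<lambda>t. norm (g (z + of_real t) - h (z + of_real t)) powr p) \<le> 2 * T * \<epsilon> powr p"
    and "1 \<le> p" "0 \<le> \<epsilon>"
    and g: "continuous_on (closed_strip \<alpha> \<beta>) g" and h: "continuous_on (closed_strip \<alpha> \<beta>) h"
  shows "weyl_dist p \<alpha> \<beta> g h \<le> ereal \<epsilon>"
  unfolding weyl_dist_def
proof (rule Limsup_bounded)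
  show "\<forall>\<^sub>F T in at_top. (SUP z\<in>closed_strip \<alpha> \<beta>.
      ereal ((1 / (2 * T) *
        (LINT t:{-T..T}|lborel. norm (g (z + of_real t) - h (z + of_real t)) powr p)) powr (1 / p))) \<le> ereal \<epsilon>"
    using le eventually_gt_at_top[of 0]
  proof eventually_elim
    case (elim T)
    show ?case
    proof (rule SUP_least)
      fix z assume z: "z \<in> closed_strip \<alpha> \<beta>"
      let ?k = "\<lambda>t. norm (g (z + of_real t) - h (z + of_real t)) powr p"
      have cont: "continuous_on {-T..T} ?k"
        by (rule continuous_on_powr_norm_diff) fact+
      have "0 \<le> integral {-T..T} ?k"
        by (intro integral_nonneg integrable_continuous_real cont) auto
      then have "(1 / (2 * T) * integral {-T..T} ?k) powr (1 / p) \<le> (\<epsilon> powr p) powr (1 / p)"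
        using elim z \<open>1 \<le> p\<close> by (intro powr_mono2) (auto simp: field_simps)
      also have "\<dots> = \<epsilon>"
        using \<open>1 \<le> p\<close> \<open>0 \<le> \<epsilon>\<close> by (simp add: powr_powr)
      finally show "ereal ((1 / (2 * T) * (LINT t:{-T..T}|lborel. ?k t)) powr (1 / p)) \<le> ereal \<epsilon>"
        by (simp add: set_lborel_integral_eq_integral[OF cont])
    qed
  qed
qed

section \<open>Boundedness on closed substrips\<close>

lemma open_strip_of_reals: "open {z. \<alpha> < Im z \<and> Im z < \<beta>}" "convex {z. \<alpha> < Im z \<and> Im z < \<beta>}"
proof -
  have *: "{z. \<alpha> < Im z \<and> Im z < \<beta>} = {z. \<alpha> < Im z} \<inter> {z. Im z < \<beta>}" by auto
  show "open {z. \<alpha> < Im z \<and> Im z < \<beta>}"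
    unfolding * by (intro open_Int open_halfspace_Im_gt open_halfspace_Im_lt)
  show "convex {z. \<alpha> < Im z \<and> Im z < \<beta>}"
    unfolding * by (intro convex_Int convex_halfspace_Im_gt convex_halfspace_Im_lt)
qed

lemma holomorphic_bounded_of_integrals_bounded:
  assumes hol: "f holomorphic_on {z. \<alpha>' < Im z \<and> Im z < \<beta>'}" 
    and "0 < T" "\<alpha>' < \<alpha>" "\<beta> < \<beta>'"
    and C: "\<And>z. \<alpha>' < Im z \<Longrightarrow> Im z < \<beta>' \<Longrightarrow> integral {-T..T} (\<lambda>t. norm (f (z + of_real t))) \<le> C"
  obtains B where "\<And>z. z \<in> closed_strip \<alpha> \<beta> \<Longrightarrow> norm (f z) \<le> B"
proof -
  let ?S = "{z. \<alpha>' < Im z \<and> Im z < \<beta>'}"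
  obtain G where "\<And>z. z \<in> ?S \<Longrightarrow> (G has_field_derivative f z) (at z within ?S)"
    using holomorphic_convex_primitive'[OF open_strip_of_reals(2,1) hol] by blast
  then have G: "(G has_field_derivative f z) (at z)" if "z \<in> ?S" for z
    using that at_within_open[OF that open_strip_of_reals(1)] by metis
  have cont: "continuous_on A (\<lambda>t::real. f (z + of_real t))" if "z \<in> ?S" for z A
    by (rule continuous_on_compose2[OF holomorphic_on_imp_continuous_on[OF hol]])
       (use that in \<open>auto intro!: continuous_intros\<close>)
  \<comment> \<open>A segment of length at most T starting at z lies in the segment of half-length T
    centred at z, and the integrand is nonnegative.\<close>
  have le: "integral {0..h} (\<lambda>t. norm (f (z + of_real t))) \<le> C" if "z \<in> ?S" "h \<in> {0..T}" for z h
    by (rule order.trans[OF integral_subset_le C])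
       (use that in \<open>auto intro!: integrable_continuous_real continuous_intros cont\<close>)
  have bound_diff: "norm (G (z + of_real h) - G z) \<le> C" if "z \<in> ?S" "h \<in> {0..T}" for z h
  proof -
    have "((\<lambda>t. f (z + of_real t)) has_integral G (z + of_real h) - G (z + of_real 0)) {0..h}"
    proof (rule fundamental_theorem_of_calculus)
      fix t :: real
      have "((\<lambda>w. G (z + w)) has_field_derivative f (z + of_real t)) (at (of_real t))"
        using G[of "z + of_real t"] that(1) DERIV_shift[of G "f (z + of_real t)" "of_real t" z]
        by (simp add: add.commute)
      then show "((\<lambda>t. G (z + of_real t)) has_vector_derivative f (z + of_real t)) (at t within {0..h})"
        by (intro has_vector_derivative_real_field has_vector_derivative_at_within)
    qed (use that in auto)
    then have "G (z + of_real h) - G z = integral {0..h} (\<lambda>t. f (z + of_real t))"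
      by (simp add: integral_unique)
    moreover have "norm (integral {0..h} (\<lambda>t. f (z + of_real t))) \<le> integral {0..h} (\<lambda>t. norm (f (z + of_real t)))"
      by (intro integral_norm_bound_integral integrable_continuous_real continuous_intros cont that) auto
    ultimately show ?thesis
      using le[OF that] by simp
  qed
  \<comment> \<open>Half the smaller margin between the two strips: a closed disc of radius r about
    a point of the inner strip stays in the open outer strip, where the increments of G are bounded
    by C. Cauchy's inequality on this disc gives the bound C / r for their derivatives.\<close>
  define r where "r = min (\<alpha> - \<alpha>') (\<beta>' - \<beta>) / 2"
  have "0 < r" and r: "r < \<alpha> - \<alpha>'" "r < \<beta>' - \<beta>"
    using assms by (simp_all add: r_def min_def)
  have osc: "norm (f (z + of_real h) - f z) \<le> C / r" if z: "z \<in> closed_strip \<alpha> \<beta>" and h: "h \<in> {0..T}" for z h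
  proof -
    have sub: "cball z r \<subseteq> ?S"
    proof
      fix w assume "w \<in> cball z r"
      then have "\<bar>Im z - Im w\<bar> \<le> r"
        using abs_Im_le_cmod[of "z - w"] by (simp add: dist_norm)
      then show "w \<in> ?S"
        using z assms(3,4) r unfolding closed_strip_def mem_Collect_eq by linarith
    qed
    let ?F = "\<lambda>w. G (w + of_real h) - G w"
    have der: "(?F has_field_derivative f (w + of_real h) - f w) (at w)" if "w \<in> ?S" for w
      using that by (intro DERIV_diff G DERIV_shift[THEN iffD1]) auto
    have "?F holomorphic_on cball z r"
      unfolding holomorphic_on_def field_differentiable_def
      using der sub has_field_derivative_at_within by blast
    then have "norm ((deriv ^^ 1) ?F z) \<le> fact 1 * C / r ^ 1"
      using \<open>0 < r\<close> sub h
      by (intro Cauchy_inequality bound_diff)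
         (auto intro: holomorphic_on_subset holomorphic_on_imp_continuous_on simp: subset_iff dist_norm)
    moreover have "deriv ?F z = f (z + of_real h) - f z"
      using \<open>0 < r\<close> by (intro DERIV_imp_deriv der subsetD[OF sub]) simp
    ultimately show ?thesis by simp
  qed
  \<comment> \<open>The constant comes from integrating |f(z)| \<le> |f(z + t)| + C / r over t in
    [0, T] and dividing by T.\<close>
  have "norm (f z) \<le> (C + T * (C / r)) / T" if z: "z \<in> closed_strip \<alpha> \<beta>" for z
  proof -
    have zS: "z \<in> ?S"
      using z assms(3,4) by (auto simp: closed_strip_def)
    have "T * norm (f z) = integral {0..T} (\<lambda>_. norm (f z))"
      using \<open>0 < T\<close> by simp
    also have "\<dots> \<le> integral {0..T} (\<lambda>t. norm (f (z + of_real t)) + C / r)"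
    proof (intro integral_le integrable_continuous_real continuous_intros cont zS)
      fix t assume "t \<in> {0..T}"
      then show "norm (f z) \<le> norm (f (z + of_real t)) + C / r"
        using osc[OF z] norm_triangle_ineq3[of "f (z + of_real t)" "f z"] by fastforce
    qed
    also have "\<dots> = integral {0..T} (\<lambda>t. norm (f (z + of_real t))) + T * (C / r)"
      using \<open>0 < T\<close> by (subst integral_add) (auto intro!: integrable_continuous_real continuous_intros cont zS)
    also have "\<dots> \<le> C + T * (C / r)"
      using le[OF zS, of T] \<open>0 < T\<close> by simp
    finally show ?thesis
      using \<open>0 < T\<close> by (simp add: field_simps)
  qed
  then show thesis by (rule that)
qed

lemma weyl_space_bounded:
  assumes hol: "f holomorphic_on {z. \<alpha>' < Im z \<and> Im z < \<beta>'}"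
    and cont: "continuous_on (closed_strip \<alpha>' \<beta>') f"
    and f: "f \<in> weyl_space p \<alpha>' \<beta>'" and "1 \<le> p" "\<alpha>' < \<alpha>" "\<beta> < \<beta>'"
  obtains B where "\<And>z. z \<in> closed_strip \<alpha> \<beta> \<Longrightarrow> norm (f z) \<le> B"
proof -
  \<comment> \<open>A single approximant at distance less than 1 is enough, since only some bound on
    the means of f is sought.\<close>
  obtain Q where Q: "Q \<in> finite_exp_sums \<alpha>' \<beta>'" and less: "weyl_dist p \<alpha>' \<beta>' f Q < ereal 1"
    using f zero_less_one[where ?'a = real] unfolding weyl_space_def by blast
  note contQ = continuous_on_finite_exp_sums[OF Q]
  obtain M where M: "0 < M" "\<And>z. z \<in> closed_strip \<alpha>' \<beta>' \<Longrightarrow> norm (Q z) \<le> M"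
    using bounded_finite_exp_sums[OF Q] by metis
  have "\<forall>\<^sub>F T in at_top. 0 < T \<and> (\<forall>z\<in>closed_strip \<alpha>' \<beta>'.
    integral {-T..T} (\<lambda>t. norm (f (z + of_real t) - Q (z + of_real t)) powr p) \<le> 2 * T * 1 powr p)"
    using weyl_dist_lessD[OF less \<open>1 \<le> p\<close> cont contQ] eventually_gt_at_top[of 0] by eventually_elim auto
  \<comment> \<open>One T suffices: the estimate is uniform in z, so this T serves as the common
    segment length for the whole strip.\<close>
  then obtain T :: real where T: "0 < T" "\<And>z. z \<in> closed_strip \<alpha>' \<beta>' \<Longrightarrow>
    integral {-T..T} (\<lambda>t. norm (f (z + of_real t) - Q (z + of_real t)) powr p) \<le> 2 * T"
    by (auto dest!: eventually_happens)
  show thesis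
  proof (rule holomorphic_bounded_of_integrals_bounded[OF hol \<open>0 < T\<close> assms(5,6)])
    fix z assume "\<alpha>' < Im z" "Im z < \<beta>'"
    then have z: "z \<in> closed_strip \<alpha>' \<beta>'" by (auto simp: closed_strip_def)
    let ?k = "\<lambda>t::real. norm (f (z + of_real t) - Q (z + of_real t)) powr p"
    have contk: "continuous_on {-T..T} ?k"
      by (rule continuous_on_powr_norm_diff) fact+
    have "integral {-T..T} (\<lambda>t. norm (f (z + of_real t))) \<le> integral {-T..T} (\<lambda>t. (1 + M) + ?k t)"
    proof (intro integral_le integrable_continuous_real contk continuous_on_add continuous_on_const
        continuous_on_norm continuous_on_horizontal_line[OF cont z])
      fix t :: real
      \<comment> \<open>This elementary inequality takes the place of Hoelder's: it bounds the
        integral of |f - Q| by that of 1 + |f - Q|^p.\<close>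
      have "u \<le> 1 + u powr p" if "0 \<le> u" for u :: real
      proof (cases "u \<le> 1")
        case False
        then have "u powr 1 \<le> u powr p"
          using \<open>1 \<le> p\<close> by (intro powr_mono) auto
        then show ?thesis using False by simp
      qed (simp add: add_increasing2)
      from this[of "norm (f (z + of_real t) - Q (z + of_real t))"]
      have "norm (f (z + of_real t) - Q (z + of_real t)) \<le> 1 + ?k t" by simp
      moreover have "norm (Q (z + of_real t)) \<le> M"
        using z by (intro M) (auto simp: closed_strip_def)
      ultimately show "norm (f (z + of_real t)) \<le> (1 + M) + ?k t"
        using norm_triangle_ineq2[of "f (z + of_real t)" "Q (z + of_real t)"] by linarith
    qed
    also have "\<dots> = 2 * T * (1 + M) + integral {-T..T} ?k"
      using \<open>0 < T\<close> by (subst integral_add) (auto intro!: integrable_continuous_real contk)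
    also have "\<dots> \<le> 2 * T * (1 + M) + 2 * T"
      using T(2)[OF z] by simp
    finally show "integral {-T..T} (\<lambda>t. norm (f (z + of_real t))) \<le> 2 * T * (1 + M) + 2 * T" .
  qed (rule that)
qed

section \<open>Changing the exponent for bounded functions\<close>

text \<open>To be applied with u = |f - P| and v = |f - Q|, where P is the truncation of Q. If v
  \<le> \<eta>, then u \<le> 2 \<eta> \<le> \<delta>^(1/q), and the term \<delta> alone suffices.
  Otherwise v^p > \<eta>^p, and K is so large that K v^p exceeds R^q, hence u^q. No order between p
  and q is assumed, and \<eta> and K are fixed before u and v, so Q may be chosen
  afterwards.\<close>

lemma powr_le_add_powr:
  fixes R \<delta> p q :: real
  assumes "0 < R" "0 < \<delta>" "0 < p" "0 < q"
  obtains \<eta> K where "0 < \<eta>" "\<eta> \<le> 1" "0 < K"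
    "\<And>u v. \<lbrakk>0 \<le> u; u \<le> R; 0 \<le> v; u \<le> v + \<eta>\<rbrakk> \<Longrightarrow> u powr q \<le> \<delta> + K * v powr p"
proof
  let ?\<eta> = "min 1 (\<delta> powr (1 / q) / 2)"
  let ?K = "R powr q / ?\<eta> powr p"
  show \<eta>: "0 < ?\<eta>" and "?\<eta> \<le> 1"
    using assms by auto
  then have "?\<eta> \<noteq> 0"
    by linarith
  then show K: "0 < ?K"
    using \<open>0 < R\<close> by (intro divide_pos_pos) (simp_all only: powr_gt_zero, simp)
  fix u v :: real
  assume uv: "0 \<le> u" "u \<le> R" "0 \<le> v" "u \<le> v + ?\<eta>"
  show "u powr q \<le> \<delta> + ?K * v powr p"
  proof (cases "v \<le> ?\<eta>")
    case True
    then have "u \<le> \<delta> powr (1 / q)"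
      using uv by linarith
    then have "u powr q \<le> (\<delta> powr (1 / q)) powr q"
      using uv assms by (intro powr_mono2) auto
    also have "\<dots> = \<delta>"
      using assms by (simp add: powr_powr)
    also have "\<dots> \<le> \<delta> + ?K * v powr p"
      using K by (simp del: zero_less_divide_iff)
    finally show ?thesis .
  next
    case False
    then have "?\<eta> powr p \<le> v powr p"
      using \<eta> assms by (intro powr_mono2) auto
    then have "?K * ?\<eta> powr p \<le> ?K * v powr p"
      using K by (intro mult_left_mono) auto
    moreover have "?K * ?\<eta> powr p = R powr q"
      using \<open>?\<eta> \<noteq> 0\<close> by (simp only: powr_eq_0_iff nonzero_eq_divide_eq[symmetric] simp_thms not_False_eq_True)
    moreover have "u powr q \<le> R powr q"
      using uv assms by (intro powr_mono2) auto
    ultimately show ?thesis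
      using assms by linarith
  qed
qed

lemma finite_exp_sums_truncate:
  assumes Q: "Q \<in> finite_exp_sums \<alpha> \<beta>" and "0 < \<eta>" "0 \<le> M"
  obtains P where "P \<in> finite_exp_sums \<alpha> \<beta>"
    "\<And>z w. z \<in> closed_strip \<alpha> \<beta> \<Longrightarrow> norm w \<le> M \<Longrightarrow> norm (w - P z) \<le> norm (w - Q z) + \<eta>"
    "\<And>z. z \<in> closed_strip \<alpha> \<beta> \<Longrightarrow> norm (P z) \<le> M + \<eta>"
proof -
  let ?D = "cball (0::complex) M"
  let ?\<phi> = "closest_point ?D"
  obtain B where B: "0 < B" "\<And>z. z \<in> closed_strip \<alpha> \<beta> \<Longrightarrow> norm (Q z) \<le> B"
    using bounded_finite_exp_sums[OF Q] by metis
  have D: "convex ?D" "closed ?D" "?D \<noteq> {}"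
    using \<open>0 \<le> M\<close> by auto
  \<comment> \<open>The polynomial approximates the retraction on a disc containing all values of Q.
    That disc, and hence g, depends on Q, but the resulting estimates involve only M and
    \<eta>.\<close>
  obtain g where g: "polynomial_function g" "\<And>w. w \<in> cball 0 B \<Longrightarrow> norm (?\<phi> w - g w) < \<eta>"
    using Stone_Weierstrass_polynomial_function[OF compact_cball continuous_on_closest_point[OF D] \<open>0 < \<eta>\<close>]
    by metis
  have near: "norm (?\<phi> (Q z) - g (Q z)) < \<eta>" if "z \<in> closed_strip \<alpha> \<beta>" for z
    using g(2) B(2)[OF that] by simp
  show thesis
  proof
    show "(\<lambda>z. g (Q z)) \<in> finite_exp_sums \<alpha> \<beta>"
      by (rule finite_exp_sums_polynomial[OF g(1) Q])
    fix z assume z: "z \<in> closed_strip \<alpha> \<beta>"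
    have "norm (?\<phi> (Q z)) \<le> M"
      using closest_point_in_set[OF D(2,3), of "Q z"] by simp
    then show "norm (g (Q z)) \<le> M + \<eta>"
      using near[OF z] norm_triangle_ineq3[of "?\<phi> (Q z)" "g (Q z)"] by linarith
    fix w :: complex assume "norm w \<le> M"
    then have "?\<phi> w = w"
      by (intro closest_point_self) simp
    then have "norm (w - ?\<phi> (Q z)) \<le> norm (w - Q z)"
      using closest_point_lipschitz[OF D, of w "Q z"] by (simp add: dist_norm)
    then show "norm (w - g (Q z)) \<le> norm (w - Q z) + \<eta>"
      using near[OF z] norm_triangle_ineq[of "w - ?\<phi> (Q z)" "?\<phi> (Q z) - g (Q z)"] by simp
  qed
qed

lemma bounded_weyl_space_exponent:
  assumes cont: "continuous_on (closed_strip \<alpha> \<beta>) f"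
    and bound: "\<And>z. z \<in> closed_strip \<alpha> \<beta> \<Longrightarrow> norm (f z) \<le> M"
    and f: "f \<in> weyl_space p \<alpha> \<beta>" and "1 \<le> p" "1 \<le> q"
  shows "f \<in> weyl_space q \<alpha> \<beta>"
  unfolding weyl_space_def
proof (intro CollectI conjI allI impI)
  show "f \<in> weyl_admissible q \<alpha> \<beta>"
    using \<open>1 \<le> q\<close> by (intro weyl_admissible_continuous cont) simp
  fix \<epsilon> :: real assume "0 < \<epsilon>"
  \<comment> \<open>Truncation needs a nonnegative radius; M can be negative when the strip is
    empty.\<close>
  define N where "N = max 0 M"
  have N: "0 \<le> N" "\<And>z. z \<in> closed_strip \<alpha> \<beta> \<Longrightarrow> norm (f z) \<le> N"
    using bound unfolding N_def by (auto simp: max.coboundedI2)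
  \<comment> \<open>Two equal halves of (\<epsilon>/2)^q: one for the constant term, one for the
    mean of order p multiplied by K. The target is \<epsilon>/2 because the final bound on the
    distance is non-strict.\<close>
  define \<delta> where "\<delta> = (\<epsilon> / 2) powr q / 2"
  have "0 < \<delta>"
    using \<open>0 < \<epsilon>\<close> by (simp add: \<delta>_def)
  \<comment> \<open>The bound R = 2 N + 1 has to be fixed before \<eta> is known. Since \<eta> \<le>
    1, it still dominates |f| + |P| \<le> N + (N + \<eta>).\<close>
  obtain \<eta> K where \<eta>: "0 < \<eta>" "\<eta> \<le> 1" and "0 < K" and
    powr_le: "\<And>u v. \<lbrakk>0 \<le> u; u \<le> 2 * N + 1; 0 \<le> v; u \<le> v + \<eta>\<rbrakk> \<Longrightarrow> u powr q \<le> \<delta> + K * v powr p"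
    using powr_le_add_powr[of "2 * N + 1" \<delta> p q] \<open>1 \<le> p\<close> \<open>1 \<le> q\<close> \<open>0 < \<delta>\<close> N by auto
  define \<gamma> where "\<gamma> = (\<delta> / K) powr (1 / p)"
  have \<gamma>: "0 < \<gamma>" "K * \<gamma> powr p = \<delta>"
    using \<open>0 < \<delta>\<close> \<open>0 < K\<close> \<open>1 \<le> p\<close> by (auto simp: \<gamma>_def powr_powr)
  obtain Q where Q: "Q \<in> finite_exp_sums \<alpha> \<beta>" and less: "weyl_dist p \<alpha> \<beta> f Q < ereal \<gamma>"
    using f \<gamma>(1) unfolding weyl_space_def by blast
  obtain P where P: "P \<in> finite_exp_sums \<alpha> \<beta>"
    "\<And>z w. z \<in> closed_strip \<alpha> \<beta> \<Longrightarrow> norm w \<le> N \<Longrightarrow> norm (w - P z) \<le> norm (w - Q z) + \<eta>"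
    "\<And>z. z \<in> closed_strip \<alpha> \<beta> \<Longrightarrow> norm (P z) \<le> N + \<eta>"
    using finite_exp_sums_truncate[OF Q \<eta>(1) N(1)] by metis
  note contQ = continuous_on_finite_exp_sums[OF Q] and contP = continuous_on_finite_exp_sums[OF P(1)]
  have pointwise: "norm (f z - P z) powr q \<le> \<delta> + K * norm (f z - Q z) powr p"
    if "z \<in> closed_strip \<alpha> \<beta>" for z
  proof (rule powr_le)
    show "norm (f z - P z) \<le> 2 * N + 1"
      using N(2)[OF that] P(3)[OF that] \<eta>(2) norm_triangle_ineq4[of "f z" "P z"] by linarith
  qed (use P(2) N(2) that in auto)
  have "weyl_dist q \<alpha> \<beta> f P \<le> ereal (\<epsilon> / 2)"
  proof (rule weyl_dist_leI[OF _ \<open>1 \<le> q\<close> _ cont contP])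
    show "\<forall>\<^sub>F T in at_top. \<forall>z\<in>closed_strip \<alpha> \<beta>.
        integral {-T..T} (\<lambda>t. norm (f (z + of_real t) - P (z + of_real t)) powr q) \<le> 2 * T * (\<epsilon> / 2) powr q"
      using weyl_dist_lessD[OF less \<open>1 \<le> p\<close> cont contQ] eventually_gt_at_top[of 0]
    proof eventually_elim
      case (elim T)
      show ?case
      proof
        fix z assume z: "z \<in> closed_strip \<alpha> \<beta>"
        let ?k = "\<lambda>t::real. norm (f (z + of_real t) - Q (z + of_real t)) powr p"
        let ?l = "\<lambda>t::real. norm (f (z + of_real t) - P (z + of_real t)) powr q"
        have contk: "continuous_on {-T..T} ?k" and contl: "continuous_on {-T..T} ?l"
          using continuous_on_powr_norm_diff cont contQ contP z \<open>1 \<le> p\<close> \<open>1 \<le> q\<close> by blast+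
        have "integral {-T..T} ?l \<le> integral {-T..T} (\<lambda>t. \<delta> + K * ?k t)"
          using z by (intro integral_le integrable_continuous_real contk contl continuous_on_add
              continuous_on_mult continuous_on_const pointwise)
            (auto simp: closed_strip_def)
        also have "\<dots> = 2 * T * \<delta> + K * integral {-T..T} ?k"
          using elim(2)
          by (subst integral_add) (auto intro!: integrable_continuous_real continuous_on_mult contk)
        also have "\<dots> \<le> 2 * T * \<delta> + K * (2 * T * \<gamma> powr p)"
          using elim(1) z \<open>0 < K\<close> by (intro add_left_mono mult_left_mono) auto
        also have "\<dots> = 2 * T * (2 * \<delta>)"
          using \<gamma>(2) by (simp add: algebra_simps)
        also have "\<dots> = 2 * T * (\<epsilon> / 2) powr q"
          by (simp add: \<delta>_def)
        finally show "integral {-T..T} ?l \<le> 2 * T * (\<epsilon> / 2) powr q" .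
      qed
    qed
  qed (use \<open>0 < \<epsilon>\<close> in simp)
  also have "\<dots> < ereal \<epsilon>"
    using \<open>0 < \<epsilon>\<close> by simp
  finally show "\<exists>Q\<in>finite_exp_sums \<alpha> \<beta>. weyl_dist q \<alpha> \<beta> f Q < ereal \<epsilon>"
    using P(1) by blast
qed

section \<open>Independence of the exponent\<close>

text \<open>The exponents are arbitrary, so exchanging them gives the reverse inclusion and thus
  equality.\<close>

lemma holo_weyl_space_subset:
  assumes "1 \<le> p" "1 \<le> q"
  shows "holo_weyl_space p a b \<subseteq> holo_weyl_space q a b"
proof
  fix f assume "f \<in> holo_weyl_space p a b"
  then have hol: "f holomorphic_on open_strip a b"
    and weyl: "\<And>\<alpha> \<beta>. \<lbrakk>a < ereal \<alpha>; \<alpha> < \<beta>; ereal \<beta> < b\<rbrakk> \<Longrightarrow> f \<in> weyl_space p \<alpha> \<beta>"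
    unfolding holo_weyl_space_def by blast+
  have sub: "closed_strip \<alpha> \<beta> \<subseteq> open_strip a b" if "a < ereal \<alpha>" "ereal \<beta> < b" for \<alpha> \<beta>
  proof
    fix z assume "z \<in> closed_strip \<alpha> \<beta>"
    then have "ereal \<alpha> \<le> ereal (Im z)" "ereal (Im z) \<le> ereal \<beta>"
      by (auto simp: closed_strip_def)
    with that show "z \<in> open_strip a b"
      unfolding open_strip_def by (blast intro: order.strict_trans1 order.strict_trans2)
  qed
  note cont = continuous_on_subset[OF holomorphic_on_imp_continuous_on[OF hol] sub]
  have "f \<in> weyl_space q \<alpha> \<beta>" if \<alpha>\<beta>: "a < ereal \<alpha>" "\<alpha> < \<beta>" "ereal \<beta> < b" for \<alpha> \<beta>
  proof -
    \<comment> \<open>The boundedness argument loses some width, so it starts from a strictly larger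
      closed strip still inside the open one. Density of the extended reals covers finite and
      infinite a and b alike. The exponent is then changed on the original strip.\<close>
    obtain \<alpha>' \<beta>' where *: "a < ereal \<alpha>'" "\<alpha>' < \<alpha>" "\<beta> < \<beta>'" "ereal \<beta>' < b"
      using ereal_dense2[OF \<alpha>\<beta>(1)] ereal_dense2[OF \<alpha>\<beta>(3)] by auto
    have "f holomorphic_on {z. \<alpha>' < Im z \<and> Im z < \<beta>'}"
      by (rule holomorphic_on_subset[OF hol order.trans[OF _ sub[OF *(1,4)]]]) (auto simp: closed_strip_def)
    then obtain M where "\<And>z. z \<in> closed_strip \<alpha> \<beta> \<Longrightarrow> norm (f z) \<le> M"
      using weyl_space_bounded[OF _ cont[OF *(1,4)] weyl[OF *(1) _ *(4)] \<open>1 \<le> p\<close> *(2,3)] * \<alpha>\<beta>(2)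
      by (metis order.strict_trans)
    then show ?thesis
      by (rule bounded_weyl_space_exponent[OF cont[OF \<alpha>\<beta>(1,3)] _ weyl[OF \<alpha>\<beta>] assms])
  qed
  with hol show "f \<in> holo_weyl_space q a b"
    unfolding holo_weyl_space_def by blast
qed

theorem theorem1:
  fixes a b :: ereal and p p' :: real
  assumes "a < b" and "p \<ge> 1" and "p' \<ge> 1"
  shows "holo_weyl_space p a b = holo_weyl_space p' a b"
  using holo_weyl_space_subset assms by blast

end
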